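(* Let $n,r$ be non-negative integers with $r\le n$. The sequence $(S^B_{n,k,r})_{k\ge0}$ of $r$-Stirling numbers of type $B$ of the second kind is log-concave in $k$, i.e. $$\bigl(S^B_{n,k,r}\bigr)^2\ge S^B_{n,k-1,r}\,S^B_{n,k+1,r}\quad\text{for all } k\ge1.$$
   Context: A set partition of $[\pm n]=\{\pm1,\dots,\pm n\}$ of type $B$ is a set partition of $[\pm n]$ such that (i) if $B$ is a block then $-B=\{-b: b\in B\}$ is also a block, and (ii) there is at most one block with $B=-B$ (called the zero block). The non-zero blocks come in pairs $\{B,-B\}$, and each pair is counted as one (representative) non-zero block. $S^B_{n,k,r}$ is the number of set partitions of $[\pm n]$ of type $B$ with exactly $k$ (representative) non-zero blocks in which none of $1,\dots,r$ lies in the zero block and $1,\dots,r$ lie in pairwise distinct pairs $\{B,-B\}$. A known fact: if $n=r$ then $S^B_{n,k,r}=\delta_{kr}$, and for $n>r$, $S^B_{n,k,r}=S^B_{n-1,k-1,r}+(2k+1)S^B_{n-1,k,r}$. *)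

theory Defs
  imports Main "HOL-Library.Disjoint_Sets"
begin

definition pm_set :: "nat \<Rightarrow> int set" where
  "pm_set n = {- int n..int n} - {0}"

abbreviation neg_block :: "int set \<Rightarrow> int set" where
  "neg_block B \<equiv> uminus ` B"

definition typeB_partition :: "nat \<Rightarrow> int set set \<Rightarrow> bool" where
  "typeB_partition n P \<longleftrightarrow>
     partition_on (pm_set n) P \<and>
     (\<forall>B\<in>P. neg_block B \<in> P) \<and>
     (\<forall>B\<in>P. \<forall>C\<in>P. B = neg_block B \<longrightarrow> C = neg_block C \<longrightarrow> B = C)"

(* The cardinality of this set of pairs is the number of representative non-zero blocks. *)
definition nonzero_block_pairs :: "int set set \<Rightarrow> int set set set" where
  "nonzero_block_pairs P = {{B, neg_block B} | B. B \<in> P \<and> B \<noteq> neg_block B}"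

definition r_separated :: "nat \<Rightarrow> int set set \<Rightarrow> bool" where
  "r_separated r P \<longleftrightarrow>
     (\<forall>i\<in>{1..int r}. \<forall>B\<in>P. i \<in> B \<longrightarrow> B \<noteq> neg_block B) \<and>
     (\<forall>i\<in>{1..int r}. \<forall>j\<in>{1..int r}. i \<noteq> j \<longrightarrow>
        (\<forall>B\<in>P. \<forall>C\<in>P. i \<in> B \<longrightarrow> j \<in> C \<longrightarrow> {B, neg_block B} \<noteq> {C, neg_block C}))"

(* Arguments in the order n, k, r. *)
definition r_Stirling2_B :: "nat \<Rightarrow> nat \<Rightarrow> nat \<Rightarrow> nat" where
  "r_Stirling2_B n k r =
     card {P. typeB_partition n P \<and> card (nonzero_block_pairs P) = k \<and> r_separated r P}"

end

theory Submission
  imports Defs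
begin

text \<open>
  The numbers satisfy the triangular recurrence
  \<open>S(n + 1, k) = (2k + 1) S(n, k) + S(n, k - 1)\<close> for \<open>n \<ge> r\<close>, and log-concavity is inherited along it.

  The recurrence holds because a signed partition of \<open>S \<union> {N, -N}\<close> is the same as a signed partition
  \<open>Q\<close> of \<open>S\<close> together with the block \<open>T\<close> that receives \<open>N\<close>; the block of \<open>-N\<close> is then forced to be
  \<open>-T\<close>. Either \<open>T = {N}\<close>, which opens a new pair of non-zero blocks, or \<open>N\<close> joins one of the \<open>2k\<close>
  non-zero blocks of \<open>Q\<close>, or \<open>N\<close> and \<open>-N\<close> both join the zero block, which is created if \<open>Q\<close> has none.
  The last two possibilities keep the number of pairs and offer \<open>2k + 1\<close> choices. That this
  correspondence is bijective is the content of \<open>extension_typeB\<close>, \<open>inj_on_extension\<close> and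
  \<open>extension_surj\<close>. The separation of \<open>1, \<dots>, r\<close> says that a block contains at most one element of
  absolute value at most \<open>r\<close> (\<open>r_separated_iff\<close>), and so it does not see where \<open>\<plusminus>N\<close> goes once
  \<open>N > r\<close>. For \<open>n = r\<close> separation leaves only the partition into singletons, so the row is supported
  at \<open>k = r\<close>.

  The inequality \<open>a(k-1) a(k+1) \<le> a(k)\<^sup>2\<close> alone does not propagate through the recurrence, since the
  cross terms compare products at distance three. The induction therefore runs with
  \<open>a(j-1) a(k+1) \<le> a(j) a(k)\<close> for all \<open>j \<le> k\<close>, which for positive sequences says that consecutive ratios
  decrease, but which also rules out internal zeros. Besides this it uses only that the weights
  \<open>2k + 1\<close> are concave in \<open>k\<close> (\<open>strongly_log_concave_step\<close>).
\<close>

section \<open>Signed partitions of a symmetric set\<close>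

text \<open>The ground set is a parameter so that adjoining a pair of points needs no arithmetic on \<open>n\<close>.\<close>

definition typeB_on :: "int set \<Rightarrow> int set set \<Rightarrow> bool" where
  "typeB_on S P \<longleftrightarrow>
     partition_on S P \<and> (\<forall>B\<in>P. neg_block B \<in> P) \<and>
     (\<forall>B\<in>P. \<forall>C\<in>P. neg_block B = B \<longrightarrow> neg_block C = C \<longrightarrow> B = C)"

definition nonzero_blocks :: "int set set \<Rightarrow> int set set" where
  "nonzero_blocks P = {B\<in>P. neg_block B \<noteq> B}"

text \<open>The zero block, or the empty set when there is none; the union makes both cases one formula.\<close>

definition zero_part :: "int set set \<Rightarrow> int set" where
  "zero_part P = \<Union>{B\<in>P. neg_block B = B}"

lemma mem_neg_block [simp]: "x \<in> neg_block B \<longleftrightarrow> - x \<in> (B :: int set)"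
  by (metis image_iff minus_minus)

lemma image_pointwise_fixed: "(\<And>x. x \<in> A \<Longrightarrow> f x = x) \<Longrightarrow> f ` A = A"
  by force

text \<open>Exchanging a pair of members of a set. The member \<open>e\<close> stands for the empty block; keeping the
  members abstract prevents equations between blocks from being unfolded into their elements.\<close>

lemma replace_pair:
  "a = e \<or> a \<in> A \<Longrightarrow> b = e \<or> b \<in> A \<Longrightarrow> e \<notin> A \<Longrightarrow> A - {a, b} \<union> {a, b} - {e} = A"
  by auto

lemma replace_pair_back:
  "a \<notin> A - {c, d} \<Longrightarrow> b \<notin> A - {c, d} \<Longrightarrow> c \<in> A \<Longrightarrow> d \<in> A \<Longrightarrow>
   A - {c, d} \<union> ({a, b} - {e}) - {a, b} \<union> {c, d} = A"
  by auto

lemma image_split_pair: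
  "a \<in> A \<Longrightarrow> b \<in> A \<Longrightarrow> f ` A = f ` (A - {a, b}) \<union> {f a, f b}"
  by auto

lemma Un_pair_minus: "e \<notin> A \<Longrightarrow> A - {c, d} \<union> {a, b} - {e} = (A - {c, d}) \<union> ({a, b} - {e})"
  by auto

lemma neg_neg_block [simp]: "neg_block (neg_block B) = (B :: int set)"
  by (simp add: image_image)

lemma neg_block_empty_iff [simp]: "neg_block B = {} \<longleftrightarrow> B = {}"
  by simp

lemma eq_neg_block_swap: "neg_block A = B \<longleftrightarrow> A = neg_block (B :: int set)"
  by (metis neg_neg_block)

text \<open>A reformulation of the separation of \<open>1, \<dots>, r\<close> that speaks of single blocks rather than of pairs
  of blocks, and hence passes at once to subsets of blocks.\<close>

definition separated :: "nat \<Rightarrow> int set set \<Rightarrow> bool" where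
  "separated r P \<longleftrightarrow>
     (\<forall>B\<in>P. \<forall>x\<in>B. \<forall>y\<in>B. \<bar>x\<bar> \<le> int r \<longrightarrow> \<bar>y\<bar> \<le> int r \<longrightarrow> x = y)"

definition separated_family :: "int set \<Rightarrow> nat \<Rightarrow> nat \<Rightarrow> int set set set" where
  "separated_family S r k =
     {P. typeB_on S P \<and> separated r P \<and> card (nonzero_block_pairs P) = k}"

lemma typeB_on_subset: "typeB_on S P \<Longrightarrow> B \<in> P \<Longrightarrow> x \<in> B \<Longrightarrow> x \<in> S"
  by (auto simp: typeB_on_def partition_on_def)

lemma typeB_on_cover: "typeB_on S P \<Longrightarrow> x \<in> S \<Longrightarrow> \<exists>B\<in>P. x \<in> B"
  by (auto simp: typeB_on_def partition_on_def)

lemma typeB_on_same: "typeB_on S P \<Longrightarrow> B \<in> P \<Longrightarrow> C \<in> P \<Longrightarrow> x \<in> B \<Longrightarrow> x \<in> C \<Longrightarrow> B = C"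
  by (auto simp: typeB_on_def partition_on_def disjoint_def)

lemma typeB_on_nonempty: "typeB_on S P \<Longrightarrow> {} \<notin> P"
  by (auto simp: typeB_on_def partition_on_def)

lemma typeB_on_neg: "typeB_on S P \<Longrightarrow> B \<in> P \<Longrightarrow> neg_block B \<in> P"
  by (auto simp: typeB_on_def)

lemma typeB_on_zero_unique:
  "typeB_on S P \<Longrightarrow> B \<in> P \<Longrightarrow> C \<in> P \<Longrightarrow> neg_block B = B \<Longrightarrow> neg_block C = C \<Longrightarrow> B = C"
  by (auto simp: typeB_on_def)

text \<open>The block shares the point with its negative, so disjointness forces them to coincide.\<close>

lemma typeB_on_symmetric_block:
  "typeB_on S P \<Longrightarrow> B \<in> P \<Longrightarrow> x \<in> B \<Longrightarrow> - x \<in> B \<Longrightarrow> neg_block B = B"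
  by (rule sym, rule typeB_on_same[of S P _ _ x]) (auto intro: typeB_on_neg)

lemma typeB_onI:
  assumes "\<And>B x. B \<in> P \<Longrightarrow> x \<in> B \<Longrightarrow> x \<in> S"
    and "\<And>x. x \<in> S \<Longrightarrow> \<exists>B\<in>P. x \<in> B"
    and "\<And>B C x. B \<in> P \<Longrightarrow> C \<in> P \<Longrightarrow> x \<in> B \<Longrightarrow> x \<in> C \<Longrightarrow> B = C"
    and "{} \<notin> P"
    and "\<And>B. B \<in> P \<Longrightarrow> neg_block B \<in> P"
    and "\<And>B C. B \<in> P \<Longrightarrow> C \<in> P \<Longrightarrow> neg_block B = B \<Longrightarrow> neg_block C = C \<Longrightarrow> B = C"
  shows "typeB_on S P"
  unfolding typeB_on_def partition_on_def disjoint_def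
proof (intro conjI ballI impI)
  show "\<Union>P = S" using assms(1,2) by blast
  show "a \<inter> b = {}" if "a \<in> P" "b \<in> P" "a \<noteq> b" for a b
    using assms(3) that by blast
qed (use assms(4,5,6) in blast)+

lemma zero_part_eq:
  assumes "typeB_on S P" "B \<in> P" "neg_block B = B"
  shows "zero_part P = B"
proof -
  have "{B\<in>P. neg_block B = B} = {B}"
    using typeB_on_zero_unique[OF assms(1)] assms(2,3) by blast
  then show ?thesis by (simp add: zero_part_def)
qed

lemma zero_part_cases:
  assumes "typeB_on S P"
  shows "zero_part P = {} \<or> zero_part P \<in> P"
proof (cases "\<exists>B\<in>P. neg_block B = B")
  case True
  then show ?thesis using zero_part_eq[OF assms] by metis
next
  case False
  then have "{B\<in>P. neg_block B = B} = {}" by blast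
  then have "zero_part P = {}" unfolding zero_part_def by (metis Union_empty)
  then show ?thesis ..
qed

lemma minus_mem_zero_part [simp]: "- x \<in> zero_part P \<longleftrightarrow> x \<in> zero_part P"
proof -
  have "- y \<in> zero_part P" if "y \<in> zero_part P" for y
  proof -
    obtain B where B: "B \<in> P" "neg_block B = B" "y \<in> B"
      using \<open>y \<in> zero_part P\<close> unfolding zero_part_def by blast
    then have "- y \<in> B" using mem_neg_block[of y B] by simp
    then show ?thesis using B(1,2) unfolding zero_part_def by blast
  qed
  from this[of x] this[of "- x"] show ?thesis by auto
qed

lemma neg_zero_part [simp]: "neg_block (zero_part P) = zero_part P"
  by (simp add: set_eq_iff)

text \<open>Non-zero blocks are easier to count than pairs: the pairs partition the non-zero blocks into
  two-element classes.\<close>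

lemma card_nonzero_blocks:
  assumes "typeB_on S P" "finite S"
  shows "card (nonzero_blocks P) = 2 * card (nonzero_block_pairs P)"
proof -
  have pairs: "nonzero_block_pairs P = (\<lambda>B. {B, neg_block B}) ` nonzero_blocks P"
    by (auto simp: nonzero_block_pairs_def nonzero_blocks_def)
  have "finite P"
    using assms by (auto simp: typeB_on_def intro: finite_elements)
  then have fin: "finite (nonzero_blocks P)" by (simp add: nonzero_blocks_def)
  have closed: "neg_block B \<in> nonzero_blocks P" if "B \<in> nonzero_blocks P" for B
    using that typeB_on_neg[OF assms(1)] by (auto simp: nonzero_blocks_def)
  have un: "\<Union>(nonzero_block_pairs P) = nonzero_blocks P"
    unfolding pairs using closed by auto
  have "2 * card (nonzero_block_pairs P) = card (\<Union>(nonzero_block_pairs P))"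
  proof (rule card_partition)
    show "finite (nonzero_block_pairs P)" using fin by (simp add: pairs)
    show "finite (\<Union>(nonzero_block_pairs P))" using fin by (simp add: un)
    show "card c = 2" if "c \<in> nonzero_block_pairs P" for c
      using that by (auto simp: nonzero_block_pairs_def card_2_iff)
    show "c \<inter> d = {}" if "c \<in> nonzero_block_pairs P" "d \<in> nonzero_block_pairs P" "c \<noteq> d" for c d
    proof -
      obtain B C where "c = {B, neg_block B}" "d = {C, neg_block C}"
        using \<open>c \<in> _\<close> \<open>d \<in> _\<close> unfolding pairs by blast
      then show ?thesis using \<open>c \<noteq> d\<close> by (auto simp: eq_neg_block_swap)
    qed
  qed
  then show ?thesis by (simp add: un)
qed

section \<open>Adjoining one pair of opposite points\<close>

locale signed_point =
  fixes S :: "int set" and N :: int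
  assumes neg_S: "x \<in> S \<Longrightarrow> - x \<in> S"
    and fresh: "N \<notin> S"
    and nz [simp]: "N \<noteq> 0"
begin

lemma neg_fresh: "- N \<notin> S"
  using neg_S[of "- N"] fresh by auto

lemma N_neq_neg: "N \<noteq> - N" "- N \<noteq> N"
  using nz by linarith+

text \<open>\<open>T\<close> is the block that receives \<open>N\<close>, so \<open>T - {N, -N}\<close> is the block of \<open>Q\<close> that \<open>N\<close> joins. It is empty if
  \<open>N\<close> joins none; removing the empty set from \<open>Q\<close> then does nothing, so the cases need no distinction.\<close>

definition extension :: "int set set \<Rightarrow> int set \<Rightarrow> int set set" where
  "extension Q T =
     (Q - {T - {N, - N}, neg_block (T - {N, - N})}) \<union> {T, neg_block T}"

definition restriction :: "int set set \<Rightarrow> int set set" where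
  "restriction P = (\<lambda>B. B - {N, - N}) ` P - {{}}"

text \<open>The possible blocks of \<open>N\<close>, in the order: a new block, a non-zero block of \<open>Q\<close>, the zero block.\<close>

definition choices :: "int set set \<Rightarrow> int set set" where
  "choices Q = insert N ` (insert {} (nonzero_blocks Q)) \<union> {insert N (insert (- N) (zero_part Q))}"

lemma neg_Diff: "neg_block (B - {N, - N}) = neg_block B - {N, - N}"
  by auto

text \<open>Through these properties of the old part \<open>C\<close> of the block, the three kinds of choice are treated
  alike when the extension is shown to be a signed partition and to restrict to \<open>Q\<close>.\<close>

lemma choices_properties:
  assumes Q: "typeB_on S Q" and T: "T \<in> choices Q"
  defines "C \<equiv> T - {N, - N}"
  shows "C = {} \<or> C \<in> Q"
    and "N \<in> T"
    and "- N \<in> T \<Longrightarrow> C = zero_part Q \<and> neg_block T = T"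
    and "- N \<notin> T \<Longrightarrow> C = {} \<or> neg_block C \<noteq> C"
proof -
  have Qd: "B - {N, - N} = B" if "B \<in> Q" for B
    using typeB_on_subset[OF Q that] fresh neg_fresh by blast
  have zd: "zero_part Q - {N, - N} = zero_part Q"
    using zero_part_cases[OF Q] Qd by auto
  consider (new) "T = {N}" | (old) B where "B \<in> Q" "neg_block B \<noteq> B" "T = insert N B"
    | (zero) "T = insert N (insert (- N) (zero_part Q))"
    using T by (auto simp: choices_def nonzero_blocks_def)
  then have "(C = {} \<or> C \<in> Q) \<and> N \<in> T \<and> (- N \<in> T \<longrightarrow> C = zero_part Q \<and> neg_block T = T)
      \<and> (- N \<notin> T \<longrightarrow> C = {} \<or> neg_block C \<noteq> C)"
  proof cases
    case new
    then show ?thesis by (simp add: C_def)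
  next
    case old
    have "- N \<notin> B" using typeB_on_subset[OF Q old(1)] neg_fresh by blast
    then have "- N \<notin> T" using old(3) N_neq_neg by blast
    moreover have "C = B" using Qd[OF old(1)] old(3) by (simp add: C_def)
    moreover have "N \<in> T" using old(3) by blast
    ultimately show ?thesis using old(1,2) by metis
  next
    case zero
    have "C = zero_part Q" using zd zero by (auto simp: C_def)
    moreover have "neg_block T = T" unfolding zero by auto
    moreover have "N \<in> T" "- N \<in> T" unfolding zero by simp_all
    ultimately show ?thesis using zero_part_cases[OF Q] by metis
  qed
  then show "C = {} \<or> C \<in> Q" "N \<in> T" "- N \<in> T \<Longrightarrow> C = zero_part Q \<and> neg_block T = T"
    "- N \<notin> T \<Longrightarrow> C = {} \<or> neg_block C \<noteq> C" by blast+
qed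

text \<open>The zero block stays unique because \<open>T\<close> is symmetric only if it absorbs the old zero block, and in
  every other case \<open>T\<close> and its negative are non-zero.\<close>

lemma extension_typeB:
  assumes Q: "typeB_on S Q" and T: "T \<in> choices Q"
  shows "typeB_on (insert N (insert (- N) S)) (extension Q T)"
proof -
  define C where "C = T - {N, - N}"
  note props = choices_properties[OF Q T, folded C_def]
  have nQ: "neg_block C = {} \<or> neg_block C \<in> Q"
    using props(1) typeB_on_neg[OF Q] by auto
  have E: "extension Q T = (Q - {C, neg_block C}) \<union> {T, neg_block T}"
    by (simp add: extension_def C_def)
  have CS: "x \<in> S" if "x \<in> C" for x
    using props(1) typeB_on_subset[OF Q _ that] that by auto
  have TC: "x \<in> C \<or> x = N \<or> x = - N" if "x \<in> T" for x
    using that by (auto simp: C_def)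
  \<comment> \<open>The new blocks \<open>T\<close> and \<open>-T\<close> are disjoint or equal.\<close>
  have TnT: "neg_block T = T" if "x \<in> T" "- x \<in> T" for x
  proof (cases "- N \<in> T")
    case True
    then show ?thesis using props(3) by blast
  next
    case False
    then have "x \<in> C" "- x \<in> C" using that by (auto simp: C_def)
    moreover from this have "C \<in> Q" using props(1) by auto
    ultimately have "neg_block C = C" using typeB_on_symmetric_block[OF Q] by blast
    then show ?thesis using props(4)[OF False] \<open>x \<in> C\<close> by auto
  qed
  \<comment> \<open>An untouched old block meets neither \<open>T\<close> nor \<open>-T\<close>.\<close>
  have oldT: "False" if "B \<in> Q" "B \<noteq> C" "B \<noteq> neg_block C" "x \<in> B" "x \<in> T \<or> - x \<in> T" for B x
  proof -
    have "x \<in> S" using typeB_on_subset[OF Q that(1,4)] .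
    then have "x \<in> C \<or> x \<in> neg_block C"
      using that(5) fresh neg_fresh by (auto simp: C_def)
    then show False
      using that props(1) nQ typeB_on_same[OF Q that(1) _ that(4)] by blast
  qed
  show ?thesis
  proof (rule typeB_onI)
    fix B x assume "B \<in> extension Q T" "x \<in> B"
    then consider "B \<in> Q" | "x \<in> T \<or> - x \<in> T" by (auto simp: E)
    then show "x \<in> insert N (insert (- N) S)"
    proof cases
      case 1
      then show ?thesis using typeB_on_subset[OF Q _ \<open>x \<in> B\<close>] by blast
    next
      case 2
      then show ?thesis using TC CS neg_S by fastforce
    qed
  next
    fix x assume "x \<in> insert N (insert (- N) S)"
    then consider "x \<in> {N, - N}" | "x \<in> S" by blast
    then show "\<exists>B\<in>extension Q T. x \<in> B"
    proof cases
      case 1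
      then show ?thesis using props(2) by (auto simp: E)
    next
      case 2
      then obtain B where "B \<in> Q" "x \<in> B" using typeB_on_cover[OF Q] by blast
      then show ?thesis
        by (cases "B = C \<or> B = neg_block C") (auto simp: E C_def)
    qed
  next
    fix A B x assume AB: "A \<in> extension Q T" "B \<in> extension Q T" "x \<in> A" "x \<in> B"
    have mem: "x \<in> T \<or> - x \<in> T" if "D \<in> {T, neg_block T}" "x \<in> D" for D
      using that mem_neg_block by blast
    have split: "D \<in> {T, neg_block T}" if "D \<in> extension Q T" "D \<notin> Q - {C, neg_block C}" for D
      using that unfolding E by blast
    show "A = B"
    proof (cases "A \<in> Q - {C, neg_block C}"; cases "B \<in> Q - {C, neg_block C}")
      assume "A \<in> Q - {C, neg_block C}" "B \<in> Q - {C, neg_block C}"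
      then show ?thesis using typeB_on_same[OF Q] AB by blast
    next
      assume A: "A \<in> Q - {C, neg_block C}" and "B \<notin> Q - {C, neg_block C}"
      then have "x \<in> T \<or> - x \<in> T" using mem[OF split[OF AB(2)] AB(4)] by simp
      then show ?thesis using oldT[of A x] A AB(3) by simp
    next
      assume B: "B \<in> Q - {C, neg_block C}" and "A \<notin> Q - {C, neg_block C}"
      then have "x \<in> T \<or> - x \<in> T" using mem[OF split[OF AB(1)] AB(3)] by simp
      then show ?thesis using oldT[of B x] B AB(4) by simp
    next
      assume "A \<notin> Q - {C, neg_block C}" "B \<notin> Q - {C, neg_block C}"
      then consider "A = B" | "A = T" "B = neg_block T" | "A = neg_block T" "B = T"
        using split[OF AB(1)] split[OF AB(2)] by (metis insert_iff singletonD)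
      then show ?thesis
      proof cases
        case 1
        then show ?thesis .
      next
        case 2
        then have "neg_block T = T" using TnT[of x] AB(3,4) by simp
        then show ?thesis using 2 by metis
      next
        case 3
        then have "neg_block T = T" using TnT[of x] AB(3,4) by simp
        then show ?thesis using 3 by metis
      qed
    qed
  next
    show "{} \<notin> extension Q T" using typeB_on_nonempty[OF Q] props(2) by (auto simp: E)
  next
    fix B assume "B \<in> extension Q T"
    then show "neg_block B \<in> extension Q T"
      unfolding E using typeB_on_neg[OF Q] by (auto simp: eq_neg_block_swap)
  next
    fix A B assume AB: "A \<in> extension Q T" "B \<in> extension Q T" "neg_block A = A" "neg_block B = B"
    have zero: "D = T" if D: "D \<in> extension Q T" "neg_block D = D" and "neg_block T = T" for D
    proof (rule ccontr)
      assume "D \<noteq> T"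
      then have "D \<in> Q" "D \<noteq> C" using D that(3) by (auto simp: E)
      moreover have "- N \<in> T" using that(3) props(2) by (metis mem_neg_block)
      ultimately show False using props(3) zero_part_eq[OF Q _ D(2)] by auto
    qed
    show "A = B"
    proof (cases "neg_block T = T")
      case True
      then show ?thesis using zero AB by metis
    next
      case False
      then have "A \<noteq> T" "A \<noteq> neg_block T" "B \<noteq> T" "B \<noteq> neg_block T"
        using AB(3,4) by (metis neg_neg_block)+
      then have "A \<in> Q" "B \<in> Q" using AB(1,2) by (auto simp: E)
      then show ?thesis using typeB_on_zero_unique[OF Q] AB(3,4) by blast
    qed
  qed
qed

lemma restriction_extension:
  assumes Q: "typeB_on S Q" and T: "T \<in> choices Q"
  shows "restriction (extension Q T) = Q"
proof -
  define C where "C = T - {N, - N}"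
  note props = choices_properties[OF Q T, folded C_def]
  have nQ: "neg_block C = {} \<or> neg_block C \<in> Q"
    using props(1) typeB_on_neg[OF Q] by auto
  have E: "extension Q T = (Q - {C, neg_block C}) \<union> {T, neg_block T}"
    by (simp add: extension_def C_def)
  have nC: "neg_block T - {N, - N} = neg_block C"
    unfolding C_def by (rule neg_Diff[symmetric])
  have Qd: "B - {N, - N} = B" if "B \<in> Q" for B
    using typeB_on_subset[OF Q that] fresh neg_fresh by blast
  have "(\<lambda>B. B - {N, - N}) ` (Q - {C, neg_block C}) = Q - {C, neg_block C}"
    by (rule image_pointwise_fixed) (use Qd in blast)
  then have "(\<lambda>B. B - {N, - N}) ` extension Q T = (Q - {C, neg_block C}) \<union> {C, neg_block C}"
    unfolding E image_Un image_insert nC C_def[symmetric] by simp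
  moreover have "Q - {C, neg_block C} \<union> {C, neg_block C} - {{}} = Q"
    using props(1) nQ typeB_on_nonempty[OF Q] by (rule replace_pair)
  ultimately show ?thesis by (simp only: restriction_def)
qed

text \<open>The block of \<open>N\<close> recovers the choice, and deleting \<open>\<plusminus>N\<close> recovers the partition; this makes the
  correspondence injective.\<close>

lemma extension_block:
  assumes Q: "typeB_on S Q" and T: "T \<in> choices Q" and B: "B \<in> extension Q T" "N \<in> B"
  shows "B = T"
  using typeB_on_same[OF extension_typeB[OF Q T] B(1) _ B(2)] choices_properties(2)[OF Q T]
  by (auto simp: extension_def)

lemma inj_on_extension:
  "inj_on (\<lambda>(Q, T). extension Q T) (SIGMA Q:{Q. typeB_on S Q}. choices Q)"
proof (rule inj_onI, clarify)
  fix Q T Q' T'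
  assume *: "typeB_on S Q" "T \<in> choices Q" "typeB_on S Q'" "T' \<in> choices Q'"
    "extension Q T = extension Q' T'"
  have "T' \<in> extension Q T" unfolding *(5) by (simp add: extension_def)
  then have "T' = T" using extension_block[OF *(1,2)] choices_properties(2)[OF *(3,4)] by blast
  moreover have "Q = Q'" using restriction_extension[OF *(1,2)] restriction_extension[OF *(3,4)] *(5) by simp
  ultimately show "Q = Q' \<and> T = T'" by simp
qed

text \<open>Only the uniqueness of the zero block is delicate. A non-empty symmetric trace of a block
  contains a point and its negative, so the block itself is symmetric, and a signed partition has
  only one such block.\<close>

lemma restriction_typeB:
  assumes P: "typeB_on (insert N (insert (- N) S)) P"
  shows "typeB_on S (restriction P)"
proof (rule typeB_onI)
  fix B x assume "B \<in> restriction P" "x \<in> B"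
  then show "x \<in> S" using typeB_on_subset[OF P] by (auto simp: restriction_def)
next
  fix x assume "x \<in> S"
  then obtain B where "B \<in> P" "x \<in> B" using typeB_on_cover[OF P] by blast
  moreover have "x \<notin> {N, - N}" using \<open>x \<in> S\<close> fresh neg_fresh by auto
  ultimately show "\<exists>B\<in>restriction P. x \<in> B"
    by (intro bexI[of _ "B - {N, - N}"]) (auto simp: restriction_def)
next
  fix A B x assume "A \<in> restriction P" "B \<in> restriction P" "x \<in> A" "x \<in> B"
  then show "A = B" using typeB_on_same[OF P, of _ _ x] unfolding restriction_def by blast
next
  show "{} \<notin> restriction P" by (simp add: restriction_def)
next
  fix B assume "B \<in> restriction P"
  then obtain B' where B': "B' \<in> P" "B = B' - {N, - N}" "B \<noteq> {}" by (auto simp: restriction_def)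
  then have "neg_block B = neg_block B' - {N, - N}" using neg_Diff by simp
  then show "neg_block B \<in> restriction P"
    unfolding restriction_def using B'(3) typeB_on_neg[OF P B'(1)]
    by (metis DiffI imageI neg_block_empty_iff singletonD)
next
  fix A B assume *: "A \<in> restriction P" "B \<in> restriction P" "neg_block A = A" "neg_block B = B"
  have sym: "\<exists>D'\<in>P. D = D' - {N, - N} \<and> neg_block D' = D'"
    if D: "D \<in> restriction P" "neg_block D = D" for D
  proof -
    obtain D' where D': "D' \<in> P" "D = D' - {N, - N}" "D \<noteq> {}"
      using D(1) by (auto simp: restriction_def)
    then obtain x where "x \<in> D" by blast
    then have "x \<in> D'" "- x \<in> D'" using D'(2) D(2) mem_neg_block[of x D] by auto
    then show ?thesis using typeB_on_symmetric_block[OF P D'(1)] D' by blast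
  qed
  then show "A = B" using typeB_on_zero_unique[OF P] * by metis
qed

text \<open>The witness is the block of \<open>N\<close>. Only this block and its negative meet \<open>{N, -N}\<close>, so restriction
  changes no other block, and extension puts these two back.\<close>

lemma extension_surj:
  assumes P: "typeB_on (insert N (insert (- N) S)) P"
  shows "\<exists>T\<in>choices (restriction P). P = extension (restriction P) T"
proof -
  obtain T where T: "T \<in> P" "N \<in> T" using typeB_on_cover[OF P] by blast
  define C where "C = T - {N, - N}"
  have nT: "neg_block T \<in> P" using typeB_on_neg[OF P T(1)] .
  have nC: "neg_block T - {N, - N} = neg_block C"
    unfolding C_def by (rule neg_Diff[symmetric])
  have other: "B - {N, - N} = B" if "B \<in> P - {T, neg_block T}" for B
  proof -
    have "N \<notin> B" using that T typeB_on_same[OF P] by blast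
    moreover have "- N \<notin> B" using that T nT typeB_on_same[OF P, of B "neg_block T" "- N"] by auto
    ultimately show ?thesis by blast
  qed
  have "(\<lambda>B. B - {N, - N}) ` P
      = (\<lambda>B. B - {N, - N}) ` (P - {T, neg_block T}) \<union> {C, neg_block C}"
    using image_split_pair[OF T(1) nT, of "\<lambda>B. B - {N, - N}"] unfolding nC C_def[symmetric] .
  also have "(\<lambda>B. B - {N, - N}) ` (P - {T, neg_block T}) = P - {T, neg_block T}"
    by (rule image_pointwise_fixed) (use other in blast)
  finally have R: "restriction P = (P - {T, neg_block T}) \<union> ({C, neg_block C} - {{}})"
    using Un_pair_minus[OF typeB_on_nonempty[OF P]] by (simp only: restriction_def)
  have notin: "C \<notin> P - {T, neg_block T}"
  proof
    assume C: "C \<in> P - {T, neg_block T}"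
    then obtain x where "x \<in> C" using typeB_on_nonempty[OF P] by (metis DiffD1 ex_in_conv)
    then show False using C T typeB_on_same[OF P, of C T x] by (auto simp: C_def)
  qed
  have notin': "neg_block C \<notin> P - {T, neg_block T}"
  proof
    assume "neg_block C \<in> P - {T, neg_block T}"
    then have "C \<in> P - {T, neg_block T}"
      using typeB_on_neg[OF P, of "neg_block C"] by (auto simp: eq_neg_block_swap)
    then show False using notin by blast
  qed
  have "P = extension (restriction P) T"
    unfolding extension_def C_def[symmetric] R
    using replace_pair_back[OF notin notin' T(1) nT] by simp
  moreover have "T \<in> choices (restriction P)"
  proof (cases "- N \<in> T")
    case True
    then have sym: "neg_block T = T" using typeB_on_symmetric_block[OF P T] by blast
    have symC: "neg_block C = C" using nC sym C_def by simp
    have "zero_part (restriction P) = C"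
    proof (cases "C = {}")
      case True
      have "D = {}" if "D \<in> restriction P" "neg_block D = D" for D
        using that R True sym typeB_on_zero_unique[OF P _ T(1)] by auto
      then show ?thesis using True unfolding zero_part_def by blast
    next
      case False
      then show ?thesis using zero_part_eq[OF restriction_typeB[OF P] _ symC] R by blast
    qed
    moreover have "T = insert N (insert (- N) C)" using True T(2) by (auto simp: C_def)
    ultimately show ?thesis by (simp add: choices_def)
  next
    case False
    then have TC: "T = insert N C" using T(2) by (auto simp: C_def)
    have "C = {} \<or> C \<in> nonzero_blocks (restriction P)"
    proof (cases "C = {}")
      case nonempty: False
      then obtain x where x: "x \<in> C" by blast
      have "neg_block C \<noteq> C"
      proof
        assume "neg_block C = C"
        then have "x \<in> T" "- x \<in> T" using x mem_neg_block[of x C] by (auto simp: C_def)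
        then have "neg_block T = T" using typeB_on_symmetric_block[OF P T(1)] by blast
        then have "- N \<in> T" using T(2) by (metis mem_neg_block minus_minus)
        then show False using False by blast
      qed
      then show ?thesis using R nonempty by (auto simp: nonzero_blocks_def)
    qed simp
    then show ?thesis using TC by (auto simp: choices_def)
  qed
  ultimately show ?thesis by blast
qed

text \<open>A new block \<open>{N}\<close> comes with \<open>{-N}\<close>; joining a non-zero block replaces it and its negative by two
  other non-zero blocks; joining the zero block leaves the non-zero blocks alone.\<close>

lemma card_nonzero_blocks_extension:
  assumes Q: "typeB_on S Q" and fin: "finite S" and T: "T \<in> choices Q"
  shows "card (nonzero_blocks (extension Q T)) = card (nonzero_blocks Q) + (if T = {N} then 2 else 0)"
proof -
  have "finite Q"
    using Q fin by (auto simp: typeB_on_def intro: finite_elements)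
  then have finQ: "finite (nonzero_blocks Q)" by (simp add: nonzero_blocks_def)
  have notinQ: "B \<notin> Q" if "N \<in> B \<or> - N \<in> B" for B
    using that typeB_on_subset[OF Q] fresh neg_fresh by blast
  consider (new) "T = {N}" | (old) B where "B \<in> Q" "neg_block B \<noteq> B" "T = insert N B"
    | (zero) "T = insert N (insert (- N) (zero_part Q))"
    using T by (auto simp: choices_def nonzero_blocks_def)
  then show ?thesis
  proof cases
    case new
    have "nonzero_blocks (extension Q T) = nonzero_blocks Q \<union> {{N}, {- N}}"
      using typeB_on_nonempty[OF Q] by (auto simp: new nonzero_blocks_def extension_def)
    moreover have "nonzero_blocks Q \<inter> {{N}, {- N}} = {}"
      using notinQ by (auto simp: nonzero_blocks_def)
    ultimately show ?thesis using new finQ by (simp add: card_Un_disjoint)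
  next
    case old
    have N: "N \<notin> B" "- N \<notin> B" using typeB_on_subset[OF Q old(1)] fresh neg_fresh by blast+
    have TB: "T - {N, - N} = B" using N old(3) by auto
    have nT: "neg_block T = insert (- N) (neg_block B)" using old(3) by simp
    have "- N \<notin> T" using N old(3) by auto
    have TnT: "neg_block T \<noteq> T"
      using \<open>- N \<notin> T\<close> old(3) nT by blast
    have eq: "nonzero_blocks (extension Q T) = (nonzero_blocks Q - {B, neg_block B}) \<union> {T, neg_block T}"
      using TnT by (auto simp: TB nonzero_blocks_def extension_def)
    have sub: "{B, neg_block B} \<subseteq> nonzero_blocks Q"
      using old typeB_on_neg[OF Q] by (auto simp: nonzero_blocks_def)
    have disj: "(nonzero_blocks Q - {B, neg_block B}) \<inter> {T, neg_block T} = {}"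
      using notinQ[of T] notinQ[of "neg_block T"] nT old(3) by (auto simp: nonzero_blocks_def)
    have "card (nonzero_blocks (extension Q T)) = card (nonzero_blocks Q - {B, neg_block B}) + card {T, neg_block T}"
      unfolding eq using finQ disj by (intro card_Un_disjoint) auto
    also have "card {T, neg_block T} = card {B, neg_block B}"
      using TnT old(2) by (metis card_2_iff)
    also have "card (nonzero_blocks Q - {B, neg_block B}) = card (nonzero_blocks Q) - card {B, neg_block B}"
      using sub by (intro card_Diff_subset) auto
    also have "\<dots> + card {B, neg_block B} = card (nonzero_blocks Q)"
      using card_mono[OF finQ sub] by simp
    finally show ?thesis
      using old typeB_on_nonempty[OF Q] N by auto
  next
    case zero
    have sym: "neg_block T = T" by (simp add: zero) blast
    have "T - {N, - N} = zero_part Q"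
      using zero_part_cases[OF Q] notinQ zero by auto
    then have "nonzero_blocks (extension Q T) = nonzero_blocks Q"
      using sym by (auto simp: nonzero_blocks_def extension_def)
    moreover have "T \<noteq> {N}" using zero by auto
    ultimately show ?thesis by simp
  qed
qed

lemma card_choices_nonsingleton:
  assumes Q: "typeB_on S Q" and fin: "finite S"
  shows "card (choices Q - {{N}}) = card (nonzero_blocks Q) + 1"
proof -
  have "finite Q"
    using Q fin by (auto simp: typeB_on_def intro: finite_elements)
  then have finQ: "finite (nonzero_blocks Q)" by (simp add: nonzero_blocks_def)
  have N: "N \<notin> B" "- N \<notin> B" if "B \<in> nonzero_blocks Q" for B
    using that typeB_on_subset[OF Q] fresh neg_fresh by (auto simp: nonzero_blocks_def)
  have "insert N B \<noteq> {N}" if "B \<in> nonzero_blocks Q" for B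
    using that N[OF that] by (auto simp: nonzero_blocks_def)
  then have eq: "choices Q - {{N}} = insert (insert N (insert (- N) (zero_part Q))) (insert N ` nonzero_blocks Q)"
    unfolding choices_def by auto
  have "insert N (insert (- N) (zero_part Q)) \<noteq> insert N B" if "B \<in> nonzero_blocks Q" for B
    using N(2)[OF that] N_neq_neg by blast
  then have "insert N (insert (- N) (zero_part Q)) \<notin> insert N ` nonzero_blocks Q"
    by auto
  moreover have "inj_on (insert N) (nonzero_blocks Q)"
    using N by (intro inj_onI) (metis insert_ident)
  ultimately show ?thesis unfolding eq using finQ by (simp add: card_image)
qed

lemma separated_extension:
  assumes Q: "typeB_on S Q" and T: "T \<in> choices Q" and large: "int r < \<bar>N\<bar>"
  shows "separated r (extension Q T) \<longleftrightarrow> separated r Q"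
proof
  define C where "C = T - {N, - N}"
  have E: "extension Q T = (Q - {C, neg_block C}) \<union> {T, neg_block T}"
    by (simp add: extension_def C_def)
  show "separated r Q" if sep: "separated r (extension Q T)"
    unfolding separated_def
  proof (intro ballI impI)
    fix B x y assume *: "B \<in> Q" "x \<in> B" "y \<in> B" "\<bar>x\<bar> \<le> int r" "\<bar>y\<bar> \<le> int r"
    have "B \<in> extension Q T \<or> B = C \<or> B = neg_block C" using *(1) unfolding E by blast
    then have "\<exists>D\<in>extension Q T. x \<in> D \<and> y \<in> D"
    proof (elim disjE)
      assume "B = C"
      then have "x \<in> T" "y \<in> T" using * by (simp_all add: C_def)
      then show ?thesis by (simp add: E)
    next
      assume "B = neg_block C"
      then have "x \<in> neg_block T" "y \<in> neg_block T" using * by (simp_all add: C_def)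
      then show ?thesis by (simp add: E)
    qed (use * in blast)
    then show "x = y" using sep *(4,5) unfolding separated_def by blast
  qed
  show "separated r (extension Q T)" if sep: "separated r Q"
    unfolding separated_def
  proof (intro ballI impI)
    fix B x y
    assume *: "B \<in> extension Q T" "x \<in> B" "y \<in> B" "\<bar>x\<bar> \<le> int r" "\<bar>y\<bar> \<le> int r"
    have inT: "u = v" if "u \<in> T" "v \<in> T" "\<bar>u\<bar> \<le> int r" "\<bar>v\<bar> \<le> int r" for u v
    proof -
      have "u \<in> C" "v \<in> C" using that large by (auto simp: C_def)
      moreover from this have "C \<in> Q" using choices_properties(1)[OF Q T] by (auto simp: C_def)
      ultimately show ?thesis using sep that(3,4) unfolding separated_def by blast
    qed
    have "B \<in> Q \<or> B = T \<or> B = neg_block T" using *(1) unfolding E by blast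
    then show "x = y"
    proof (elim disjE)
      assume "B \<in> Q"
      then show ?thesis using sep * unfolding separated_def by blast
    next
      assume "B = T"
      then show ?thesis using inT * by blast
    next
      assume "B = neg_block T"
      then show ?thesis using inT[of "- x" "- y"] * by simp
    qed
  qed
qed

lemma card_pairs_extension:
  assumes Q: "typeB_on S Q" and fin: "finite S" and T: "T \<in> choices Q"
  shows "card (nonzero_block_pairs (extension Q T)) =
    card (nonzero_block_pairs Q) + (if T = {N} then 1 else 0)"
proof -
  have "finite (insert N (insert (- N) S))" using fin by simp
  from card_nonzero_blocks[OF extension_typeB[OF Q T] this] card_nonzero_blocks[OF Q fin]
    card_nonzero_blocks_extension[OF Q fin T]
  show ?thesis by (auto split: if_splits)
qed

lemma finite_separated_family: "finite S' \<Longrightarrow> finite (separated_family S' r k)"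
  unfolding separated_family_def typeB_on_def
  by (rule finite_subset[OF _ finitely_many_partition_on[of S']]) auto

text \<open>Counting the pairs \<open>(Q, T)\<close> that yield \<open>k\<close> pairs of non-zero blocks: those with \<open>T \<noteq> {N}\<close> start from
  \<open>k\<close> pairs, with \<open>2k + 1\<close> choices of \<open>T\<close>, and those with \<open>T = {N}\<close> start from \<open>k - 1\<close> pairs.\<close>

lemma card_separated_family_extend:
  assumes fin: "finite S" and large: "int r < \<bar>N\<bar>"
  shows "card (separated_family (insert N (insert (- N) S)) r k) =
    (2 * k + 1) * card (separated_family S r k)
    + (if k = 0 then 0 else card (separated_family S r (k - 1)))"
proof -
  \<comment> \<open>The case \<open>k = 0\<close> is separate because \<open>k - 1\<close> would be \<open>0\<close> again.\<close>
  define lower where "lower = (if k = 0 then {} else separated_family S r (k - 1))"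
  define X where "X = (SIGMA Q:separated_family S r k. choices Q - {{N}})"
  define Y where "Y = lower \<times> {{N}}"
  have single: "{N} \<in> choices Q" for Q by (simp add: choices_def)
  have sub: "X \<union> Y \<subseteq> (SIGMA Q:{Q. typeB_on S Q}. choices Q)"
    using single by (auto simp: X_def Y_def lower_def separated_family_def split: if_splits)
  have inXY: "(Q, T) \<in> X \<union> Y \<longleftrightarrow>
      extension Q T \<in> separated_family (insert N (insert (- N) S)) r k"
    if Q: "typeB_on S Q" and T: "T \<in> choices Q" for Q T
    using extension_typeB[OF Q T] separated_extension[OF Q T large] card_pairs_extension[OF Q fin T] Q T
    by (auto simp: X_def Y_def lower_def separated_family_def)
  have "separated_family (insert N (insert (- N) S)) r k = (\<lambda>(Q, T). extension Q T) ` (X \<union> Y)"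
  proof (intro equalityI subsetI)
    fix P assume P: "P \<in> separated_family (insert N (insert (- N) S)) r k"
    then have ty: "typeB_on (insert N (insert (- N) S)) P" by (simp add: separated_family_def)
    obtain T where T: "T \<in> choices (restriction P)" "P = extension (restriction P) T"
      using extension_surj[OF ty] by blast
    then have "(restriction P, T) \<in> X \<union> Y"
      using inXY[OF restriction_typeB[OF ty] T(1)] P by simp
    then show "P \<in> (\<lambda>(Q, T). extension Q T) ` (X \<union> Y)"
      using T(2) by (intro image_eqI[of _ _ "(restriction P, T)"]) simp_all
  next
    fix P assume "P \<in> (\<lambda>(Q, T). extension Q T) ` (X \<union> Y)"
    then obtain Q T where QT: "(Q, T) \<in> X \<union> Y" "P = extension Q T" by auto
    then have "typeB_on S Q" "T \<in> choices Q" using sub by blast+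
    then show "P \<in> separated_family (insert N (insert (- N) S)) r k" using inXY QT by blast
  qed
  then have "card (separated_family (insert N (insert (- N) S)) r k) = card (X \<union> Y)"
    using card_image[OF inj_on_subset[OF inj_on_extension sub]] by simp
  also have "\<dots> = card X + card Y"
  proof (rule card_Un_disjoint)
    have "finite (choices Q)" if "typeB_on S Q" for Q
    proof -
      have "finite Q" using that fin by (auto simp: typeB_on_def intro: finite_elements)
      then show ?thesis by (simp add: choices_def nonzero_blocks_def)
    qed
    then show "finite X"
      unfolding X_def using finite_separated_family[OF fin]
      by (intro finite_SigmaI finite_Diff) (auto simp: separated_family_def)
    show "finite Y" using finite_separated_family[OF fin] by (simp add: Y_def lower_def)
    show "X \<inter> Y = {}" by (auto simp: X_def Y_def)
  qed
  also have "card X = (2 * k + 1) * card (separated_family S r k)"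
  proof -
    have "card (choices Q - {{N}}) = 2 * k + 1" if "Q \<in> separated_family S r k" for Q
      using that card_choices_nonsingleton[of Q] card_nonzero_blocks[of S Q] fin
      by (simp add: separated_family_def)
    moreover have "card X = (\<Sum>Q\<in>separated_family S r k. card (choices Q - {{N}}))"
      unfolding X_def
    proof (rule card_SigmaI)
      show "finite (separated_family S r k)" using finite_separated_family[OF fin] .
      show "\<forall>Q\<in>separated_family S r k. finite (choices Q - {{N}})"
        using calculation by (metis card.infinite add_is_0 one_neq_zero)
    qed
    ultimately show ?thesis by simp
  qed
  also have "card Y = (if k = 0 then 0 else card (separated_family S r (k - 1)))"
    by (simp add: Y_def lower_def card_cartesian_product)
  finally show ?thesis .
qed

end

section \<open>The recurrence for the r-Stirling numbers of type B\<close>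

lemma separatedD:
  "separated r P \<Longrightarrow> B \<in> P \<Longrightarrow> x \<in> B \<Longrightarrow> y \<in> B \<Longrightarrow> \<bar>x\<bar> \<le> int r \<Longrightarrow> \<bar>y\<bar> \<le> int r \<Longrightarrow> x = y"
  unfolding separated_def by blast

text \<open>Two elements of absolute value at most \<open>r\<close> in one block are either opposite, and then the block
  is the zero block, or they have different absolute values \<open>i \<noteq> j\<close>, and then \<open>i\<close> and \<open>j\<close> lie in the
  same pair of blocks. Since \<open>0\<close> is not in the ground set, the absolute values do lie in \<open>{1..r}\<close>.\<close>

lemma r_separated_iff:
  assumes P: "typeB_on S P" and "0 \<notin> S"
  shows "r_separated r P \<longleftrightarrow> separated r P"
proof
  assume sep: "separated r P"
  show "r_separated r P"
    unfolding r_separated_def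
  proof (intro conjI ballI impI)
    fix i B assume i: "i \<in> {1..int r}" "B \<in> P" "i \<in> B"
    show "B \<noteq> neg_block B"
    proof
      assume "B = neg_block B"
      then have "- i \<in> B" using i(3) by (metis mem_neg_block minus_minus)
      moreover have "\<bar>i\<bar> \<le> int r" "\<bar>- i\<bar> \<le> int r" using i(1) by simp_all
      ultimately have "i = - i" using separatedD[OF sep i(2,3)] by blast
      then show False using i(1) by simp
    qed
  next
    fix i j B C
    assume *: "i \<in> {1..int r}" "j \<in> {1..int r}" "i \<noteq> j" "B \<in> P" "C \<in> P" "i \<in> B" "j \<in> C"
    show "{B, neg_block B} \<noteq> {C, neg_block C}"
    proof
      assume "{B, neg_block B} = {C, neg_block C}"
      then have "B = C \<or> B = neg_block C" by (metis doubleton_eq_iff)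
      then have "j \<in> B \<or> - j \<in> B" using *(7) by auto
      moreover have "\<bar>i\<bar> \<le> int r" "\<bar>j\<bar> \<le> int r" "\<bar>- j\<bar> \<le> int r" using *(1,2) by simp_all
      ultimately have "i = j \<or> i = - j" using separatedD[OF sep *(4,6)] by blast
      then show False using * by auto
    qed
  qed
next
  assume sep: "r_separated r P"
  have nonzero: "B \<noteq> neg_block B" if "B \<in> P" "i \<in> B" "i \<in> {1..int r}" for B i
    using sep that by (simp add: r_separated_def)
  have apart: "i = j"
    if "B \<in> P" "C \<in> P" "i \<in> B" "j \<in> C" "i \<in> {1..int r}" "j \<in> {1..int r}"
      "{B, neg_block B} = {C, neg_block C}" for B C i j
    using sep that unfolding r_separated_def by metis
  show "separated r P"
    unfolding separated_def
  proof (intro ballI impI)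
    fix B x y assume *: "B \<in> P" "x \<in> B" "y \<in> B" "\<bar>x\<bar> \<le> int r" "\<bar>y\<bar> \<le> int r"
    have n: "neg_block B \<in> P" using typeB_on_neg[OF P *(1)] .
    have signed: "\<exists>D\<in>{B, neg_block B}. \<bar>z\<bar> \<in> D \<and> \<bar>z\<bar> \<in> {1..int r}"
      if "z \<in> B" "\<bar>z\<bar> \<le> int r" for z
    proof -
      have "z \<noteq> 0" using typeB_on_subset[OF P *(1) that(1)] \<open>0 \<notin> S\<close> by auto
      then show ?thesis using that by (cases "z < 0") auto
    qed
    obtain D D' where D: "D \<in> {B, neg_block B}" "\<bar>x\<bar> \<in> D" "\<bar>x\<bar> \<in> {1..int r}"
        "D' \<in> {B, neg_block B}" "\<bar>y\<bar> \<in> D'" "\<bar>y\<bar> \<in> {1..int r}"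
      using signed[OF *(2,4)] signed[OF *(3,5)] by blast
    have pair: "{E, neg_block E} = {B, neg_block B}" if E: "E \<in> {B, neg_block B}" for E
    proof -
      consider "E = B" | "E = neg_block B" using E by (metis insertE singletonD)
      then show ?thesis by cases (simp_all only: neg_neg_block insert_commute)
    qed
    have "D \<in> P" "D' \<in> P" using D(1,4) n *(1) by (metis insertE singletonD)+
    then have abs: "\<bar>x\<bar> = \<bar>y\<bar>" 
      using apart[OF _ _ D(2,5,3,6)] pair[OF D(1)] pair[OF D(4)] by simp
    show "x = y"
    proof (rule ccontr)
      assume "x \<noteq> y"
      then have "y = - x" using abs by linarith
      then have "neg_block B = B" using typeB_on_symmetric_block[OF P *(1,2)] *(3) by simp
      then have "D = neg_block D" using D(1) by (metis empty_iff insert_iff)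
      then show False using nonzero[OF \<open>D \<in> P\<close> D(2,3)] by contradiction
    qed
  qed
qed

lemma r_Stirling2_B_eq: "r_Stirling2_B n k r = card (separated_family (pm_set n) r k)"
proof -
  have "typeB_partition n P \<longleftrightarrow> typeB_on (pm_set n) P" for P
    by (simp only: typeB_partition_def typeB_on_def eq_neg_block_swap)
  moreover have "0 \<notin> pm_set n" by (simp add: pm_set_def)
  ultimately have "{P. typeB_partition n P \<and> card (nonzero_block_pairs P) = k \<and> r_separated r P}
      = separated_family (pm_set n) r k"
    unfolding separated_family_def using r_separated_iff by blast
  then show ?thesis by (simp add: r_Stirling2_B_def)
qed

lemma r_Stirling2_B_Suc:
  assumes "r \<le> n"
  shows "r_Stirling2_B (Suc n) k r =
    (2 * k + 1) * r_Stirling2_B n k r + (if k = 0 then 0 else r_Stirling2_B n (k - 1) r)"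
proof -
  interpret signed_point "pm_set n" "int (Suc n)"
    by unfold_locales (auto simp: pm_set_def)
  have "pm_set (Suc n) = insert (int (Suc n)) (insert (- int (Suc n)) (pm_set n))"
    by (auto simp: pm_set_def)
  then show ?thesis
    using card_separated_family_extend[of r k] assms by (simp add: r_Stirling2_B_eq pm_set_def)
qed

text \<open>For \<open>n = r\<close> every element is small, so all blocks are singletons and there are exactly \<open>n\<close> pairs.\<close>

lemma r_Stirling2_B_diagonal: "k \<noteq> n \<Longrightarrow> r_Stirling2_B n k n = 0"
proof -
  assume "k \<noteq> n"
  have "card (nonzero_block_pairs P) = n" if P: "typeB_on (pm_set n) P" and sep: "separated n P" for P
  proof -
    have small: "\<bar>x\<bar> \<le> int n" if "x \<in> pm_set n" for x using that by (auto simp: pm_set_def)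
    have block: "B = {x}" if "B \<in> P" "x \<in> B" for B x
      using sep that small typeB_on_subset[OF P that(1)] unfolding separated_def by blast
    have "P = (\<lambda>x. {x}) ` pm_set n"
    proof (intro equalityI subsetI)
      fix B assume "B \<in> P"
      moreover obtain x where "x \<in> B" using \<open>B \<in> P\<close> typeB_on_nonempty[OF P] by (metis ex_in_conv)
      ultimately show "B \<in> (\<lambda>x. {x}) ` pm_set n"
        using block[of B x] typeB_on_subset[OF P] by blast
    next
      fix B assume "B \<in> (\<lambda>x. {x}) ` pm_set n"
      then obtain x where x: "x \<in> pm_set n" "B = {x}" by blast
      then obtain D where "D \<in> P" "x \<in> D" using typeB_on_cover[OF P] by blast
      then show "B \<in> P" using block[of D x] x(2) by simp
    qed
    then have "nonzero_blocks P = (\<lambda>x. {x}) ` pm_set n"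
      by (auto simp: nonzero_blocks_def pm_set_def)
    then have "card (nonzero_blocks P) = card (pm_set n)"
      by (simp add: card_image)
    also have "\<dots> = 2 * n"
      by (simp add: pm_set_def)
    finally show ?thesis using card_nonzero_blocks[OF P] by (simp add: pm_set_def)
  qed
  then have "separated_family (pm_set n) n k = {}"
    using \<open>k \<noteq> n\<close> by (auto simp: separated_family_def)
  then show ?thesis by (simp add: r_Stirling2_B_eq)
qed

section \<open>Log-concavity from the recurrence\<close>

text \<open>The index is shifted by one against \<open>a(j-1) a(k+1) \<le> a(j) a(k)\<close>, which avoids subtraction on the
  natural numbers.\<close>

definition strongly_log_concave :: "(nat \<Rightarrow> nat) \<Rightarrow> bool" where
  "strongly_log_concave a \<longleftrightarrow> (\<forall>j k. j \<le> k \<longrightarrow> a j * a (k + 2) \<le> a (j + 1) * a (k + 1))"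

text \<open>Expand both products by the recurrence. Writing \<open>u, v, w\<close> for \<open>a\<close> at \<open>j - 1, j, j + 1\<close> and
  \<open>p, q, s\<close> for \<open>a\<close> at \<open>k, k + 1, k + 2\<close>, the terms without weights and those with two weights compare
  one to one. The two mixed terms compare only as a sum: \<open>u s\<close> has weight \<open>2k + 5\<close> against \<open>2k + 3\<close> for
  \<open>v q\<close>, and the excess \<open>2\<close> is made up by the step from \<open>2j + 1\<close> to \<open>2j + 3\<close> in the other term. The
  value of \<open>u\<close> at \<open>j = 0\<close> is \<open>0\<close>, as the recurrence requires.\<close>

lemma strongly_log_concave_step:
  assumes a: "strongly_log_concave a"
    and b: "\<And>k. b k = (2 * k + 1) * a k + (if k = 0 then 0 else a (k - 1))"
  shows "strongly_log_concave b"
  unfolding strongly_log_concave_def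
proof (intro allI impI)
  fix j k :: nat assume "j \<le> k"
  define u v where "u = (if j = 0 then 0 else a (j - 1))" and "v = a j"
  define w where "w = a (j + 1)"
  define p q s where "p = a k" and "q = a (k + 1)" and "s = a (k + 2)"
  have ratio: "a m * a (l + 2) \<le> a (m + 1) * a (l + 1)" if "m \<le> l" for m l
    using a that by (simp add: strongly_log_concave_def)
  have uq: "u * q \<le> v * p"
  proof (cases j)
    case (Suc i)
    moreover obtain l where "k = Suc l" using \<open>j \<le> k\<close> Suc by (cases k) auto
    ultimately show ?thesis
      using ratio[of i l] \<open>j \<le> k\<close> by (simp add: u_def v_def p_def q_def)
  qed (simp add: u_def)
  have us: "u * s \<le> v * q"
  proof (cases j)
    case (Suc i)
    then show ?thesis
      using ratio[of i k] \<open>j \<le> k\<close> by (simp add: u_def v_def s_def q_def)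
  qed (simp add: u_def)
  have vs: "v * s \<le> w * q"
    using ratio[OF \<open>j \<le> k\<close>] by (simp add: v_def w_def s_def q_def)
  \<comment> \<open>For \<open>j = k\<close> both sides are the same product; otherwise the indices \<open>j \<le> k - 1\<close> are admissible.\<close>
  have vq: "v * q \<le> w * p"
  proof (cases "j = k")
    case False
    then obtain l where "k = Suc l" "j \<le> l" using \<open>j \<le> k\<close> by (cases k) auto
    then show ?thesis using ratio[of j l] by (simp add: v_def w_def p_def q_def)
  qed (simp add: v_def w_def p_def q_def)
  have recurrence: "b j = (2 * j + 1) * v + u" "b (k + 2) = (2 * k + 5) * s + q"
      "b (j + 1) = (2 * j + 3) * w + v" "b (k + 1) = (2 * k + 3) * q + p"
    by (simp_all add: b u_def v_def w_def p_def q_def s_def algebra_simps)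
  have coeff: "(2 * j + 1) * (2 * k + 5) \<le> (2 * j + 3) * (2 * k + 3)"
    using \<open>j \<le> k\<close> by (simp add: algebra_simps)
  have middle: "(2 * j + 1) * (v * q) + (2 * k + 5) * (u * s)
      \<le> (2 * j + 3) * (w * p) + (2 * k + 3) * (v * q)"
  proof -
    have "(2 * j + 1) * (v * q) + (2 * k + 5) * (u * s)
        \<le> (2 * j + 1) * (v * q) + (2 * k + 5) * (v * q)"
      using us by (intro add_left_mono mult_left_mono) simp_all
    also have "\<dots> = (2 * j + 3) * (v * q) + (2 * k + 3) * (v * q)"
      by (simp add: algebra_simps)
    also have "\<dots> \<le> (2 * j + 3) * (w * p) + (2 * k + 3) * (v * q)"
      using vq by (intro add_right_mono mult_left_mono) simp_all
    finally show ?thesis .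
  qed
  have "b j * b (k + 2) = ((2 * j + 1) * v + u) * ((2 * k + 5) * s + q)"
    by (simp only: recurrence)
  also have "\<dots> = (2 * j + 1) * (2 * k + 5) * (v * s)
      + ((2 * j + 1) * (v * q) + (2 * k + 5) * (u * s)) + u * q"
    by (simp add: algebra_simps)
  also have "\<dots> \<le> (2 * j + 3) * (2 * k + 3) * (w * q)
      + ((2 * j + 3) * (w * p) + (2 * k + 3) * (v * q)) + v * p"
    by (rule add_mono[OF add_mono[OF mult_mono[OF coeff vs] middle] uq]) simp_all
  also have "\<dots> = ((2 * j + 3) * w + v) * ((2 * k + 3) * q + p)"
    by (simp add: algebra_simps)
  also have "\<dots> = b (j + 1) * b (k + 1)"
    by (simp only: recurrence)
  finally show "b j * b (k + 2) \<le> b (j + 1) * b (k + 1)" .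
qed

lemma strongly_log_concave_r_Stirling2_B:
  assumes "r \<le> n"
  shows "strongly_log_concave (\<lambda>k. r_Stirling2_B n k r)"
  using assms
proof (induction n rule: dec_induct)
  case base
  have "r_Stirling2_B r j r * r_Stirling2_B r (k + 2) r = 0" if "j \<le> k" for j k
    using r_Stirling2_B_diagonal[of j r] r_Stirling2_B_diagonal[of "k + 2" r] that
    by (cases "j = r") auto
  then show ?case unfolding strongly_log_concave_def by (metis zero_le)
next
  case (step n)
  then show ?case
    by (intro strongly_log_concave_step[OF step.IH] r_Stirling2_B_Suc) simp
qed

theorem proposition3p15:
  fixes n r k :: nat
  assumes "r \<le> n" and "k \<ge> 1"
  shows "(r_Stirling2_B n k r)\<^sup>2 \<ge> r_Stirling2_B n (k - 1) r * r_Stirling2_B n (k + 1) r"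
proof -
  obtain j where "k = Suc j" using assms(2) by (cases k) auto
  then show ?thesis
    using strongly_log_concave_r_Stirling2_B[OF assms(1)]
    by (auto simp: strongly_log_concave_def power2_eq_square)
qed

end
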